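(* Let $l,m\ge1$ be integers, $n=l+m+2$, $Y_0>0$, and let $\tilde H:[0,Y_0]\to\mathbb{R}$ be a (measurable) function. With $F_1,F_2,F_3$ as defined in the context: (i) If $\tilde H$ is bounded, then there exist constants $M>0$ and $Y\in(0,Y_0]$ such that the integral equation $$r(y)=\frac1{y^{l+m}}\int_0^y\bigl\{F_1(r(\eta))+F_2(r(\cdot),\eta)+F_3(r(\eta),\eta)\bigr\}\,\eta^{l+m-1}\,d\eta,\qquad y\in(0,Y],$$ has a unique solution $r$ in $X_{Y,M}$. (ii) If $\tilde H$ is bounded and continuous, then the solution $r$ given in (i) is a solution of the singular initial value problem $$y\frac{dr}{dy}=-(l+m)\,r(y)+F_1(r(y))+F_2(r(\cdot),y)+F_3(r(y),y)\quad(0<y\le Y),\qquad r(0)=0.$$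
   Context: For a function $r$ on $(0,Y]$, integrable near $0$, put $$F_1(r(y))=-r(y)^2\bigl(m\,r(y)+2\sqrt{lm}\bigr),$$ $$F_2(r(\cdot),y)=-\sqrt{lm}\left\{1+\left(r(y)+\sqrt{\tfrac lm}\right)^2\right\}\frac{\frac{\sqrt m}{y}\int_0^y r(\xi)\,d\xi}{\frac{\sqrt m}{y}\int_0^y r(\xi)\,d\xi+\sqrt l},$$ $$F_3(r(y),y)=(n-1)\tilde H(y)\left\{1+\left(r(y)+\sqrt{\tfrac lm}\right)^2\right\}^{3/2}y.$$ A solution is understood to be such that the denominator in $F_2$ does not vanish on $(0,Y]$. For $Y,M>0$: $\|r\|_X=\sup_{y\in(0,Y]}|r(y)/y|$, $X_Y=\{r\in C((0,Y]): \|r\|_X<\infty\}$, a Banach space, and $X_{Y,M}=\{r\in X_Y:\|r\|_X\le M\}$. Every $r\in X_Y$ is extended continuously to $[0,Y]$ by $r(0)=0$. *)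

theory Defs
  imports "HOL-Analysis.Analysis"
begin

text \<open>Integrals from \<open>0\<close> to \<open>y\<close> are Lebesgue integrals, written over the half-open interval
  because the unknown \<open>r\<close> is a function on \<open>(0,Y]\<close>.\<close>

definition F1 :: "nat \<Rightarrow> nat \<Rightarrow> real \<Rightarrow> real" where
  "F1 l m \<rho> = - \<rho>\<^sup>2 * (real m * \<rho> + 2 * sqrt (real l * real m))"

definition F2_denom :: "nat \<Rightarrow> nat \<Rightarrow> (real \<Rightarrow> real) \<Rightarrow> real \<Rightarrow> real" where
  "F2_denom l m r y = sqrt (real m) / y * (LINT \<xi>:{0<..y}|lebesgue. r \<xi>) + sqrt (real l)"

definition F2 :: "nat \<Rightarrow> nat \<Rightarrow> (real \<Rightarrow> real) \<Rightarrow> real \<Rightarrow> real" where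
  "F2 l m r y =
     - sqrt (real l * real m) * (1 + (r y + sqrt (real l / real m))\<^sup>2) *
       ((sqrt (real m) / y * (LINT \<xi>:{0<..y}|lebesgue. r \<xi>)) / F2_denom l m r y)"

definition F3 :: "nat \<Rightarrow> nat \<Rightarrow> nat \<Rightarrow> (real \<Rightarrow> real) \<Rightarrow> real \<Rightarrow> real \<Rightarrow> real" where
  "F3 l m n H \<rho> y =
     (real n - 1) * H y * (1 + (\<rho> + sqrt (real l / real m))\<^sup>2) powr (3 / 2) * y"

definition X_norm :: "real \<Rightarrow> (real \<Rightarrow> real) \<Rightarrow> real" where
  "X_norm Y r = (SUP y\<in>{0<..Y}. \<bar>r y / y\<bar>)"

text \<open>Functions on \<open>(0,Y]\<close> are extensional, so that equality of elements of \<open>X_space Y\<close> is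
  equality on \<open>(0,Y]\<close>. Boundedness of the quotient expresses finiteness of the norm, since the
  real-valued supremum of an unbounded set is meaningless.\<close>

definition X_space :: "real \<Rightarrow> (real \<Rightarrow> real) set" where
  "X_space Y = {r \<in> extensional {0<..Y}.
     continuous_on {0<..Y} r \<and> bdd_above ((\<lambda>y. \<bar>r y / y\<bar>) ` {0<..Y})}"

definition X_ball :: "real \<Rightarrow> real \<Rightarrow> (real \<Rightarrow> real) set" where
  "X_ball Y M = {r \<in> X_space Y. X_norm Y r \<le> M}"

definition integral_eq_solution ::
    "nat \<Rightarrow> nat \<Rightarrow> nat \<Rightarrow> (real \<Rightarrow> real) \<Rightarrow> real \<Rightarrow> (real \<Rightarrow> real) \<Rightarrow> bool" where
  "integral_eq_solution l m n H Y r \<longleftrightarrow>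
     (\<forall>y\<in>{0<..Y}. F2_denom l m r y \<noteq> 0) \<and>
     (\<forall>y\<in>{0<..Y}.
        set_integrable lebesgue {0<..y}
          (\<lambda>\<eta>. (F1 l m (r \<eta>) + F2 l m r \<eta> + F3 l m n H (r \<eta>) \<eta>) * \<eta> ^ (l + m - 1)) \<and>
        r y = 1 / y ^ (l + m) *
          (LINT \<eta>:{0<..y}|lebesgue.
             (F1 l m (r \<eta>) + F2 l m r \<eta> + F3 l m n H (r \<eta>) \<eta>) * \<eta> ^ (l + m - 1)))"

text \<open>Here \<open>u\<close> is a function on \<open>[0,Y]\<close>; the derivative at \<open>Y\<close> is the left-hand one. The initial
  condition is attained continuously.\<close>

definition ivp_solution ::
    "nat \<Rightarrow> nat \<Rightarrow> nat \<Rightarrow> (real \<Rightarrow> real) \<Rightarrow> real \<Rightarrow> (real \<Rightarrow> real) \<Rightarrow> bool" where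
  "ivp_solution l m n H Y u \<longleftrightarrow>
     (\<forall>y\<in>{0<..Y}. F2_denom l m u y \<noteq> 0) \<and>
     (\<forall>y\<in>{0<..Y}. \<exists>D. (u has_real_derivative D) (at y within {0..Y}) \<and>
        y * D = - real (l + m) * u y + F1 l m (u y) + F2 l m u y + F3 l m n H (u y) y) \<and>
     continuous_on {0..Y} u \<and> u 0 = 0"

end

theory Submission
  imports Defs
begin

text \<open>
  The linear part of the right-hand side at \<open>r = 0\<close> is \<open>-(l + m)\<close> times the mean
  \<open>(1/y) \<integral>\<^sub>0\<^sup>y r\<close>, which comes from \<open>F\<^sub>2\<close>. Averaging a function bounded by \<open>C y\<close> gains a factor
  \<open>1/2\<close>, and integrating against \<open>\<eta>\<^bsup>l+m-1\<^esup>/y\<^bsup>l+m\<^esup>\<close> gains a factor \<open>1/(l + m + 1)\<close>. On small functions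
  all other contributions have small Lipschitz constants (for \<open>F\<^sub>3\<close> thanks to the explicit
  factor \<open>y\<close>), so for small \<open>Y\<close> the integral operator contracts the ball with constant
  \<open>1/2\<close>. If \<open>H\<close> is continuous, the integrand is continuous on \<open>(0,Y]\<close>, and the differential equation
  results from differentiating \<open>y\<^bsup>l+m\<^esup> r(y)\<close>.
\<close>

section \<open>Integrals over half-open intervals\<close>

lemma negligible_zero_Ioc: "negligible {x \<in> {0..y} - {0<..y::real}. f x \<noteq> (0::real)}"
  by (rule negligible_subset[of "{0}"]) auto

text \<open>The two intervals differ by the null set {0}. This passage to the gauge integral over
  \<open>{0..y}\<close> makes continuity of the indefinite integral and the fundamental theorem of
  calculus available.\<close>

lemma set_LINT_Ioc:
  fixes f :: "real \<Rightarrow> real"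
  assumes "set_integrable lebesgue {0<..y} f"
  shows "f integrable_on {0..y}"
    and "(LINT \<xi>:{0<..y}|lebesgue. f \<xi>) = integral {0..y} f"
proof -
  have "f absolutely_integrable_on {0..y}"
    using assms negligible_zero_Ioc[of y f]
    by (subst absolutely_integrable_spike_set_eq[where T="{0<..y}"])
       (auto intro: empty_imp_negligible)
  then show "f integrable_on {0..y}"
    by (rule set_lebesgue_integral_eq_integral(1))
  have "integral {0<..y} f = integral {0..y} f"
    by (rule integral_spike_set)
       (use negligible_zero_Ioc[of y f] in \<open>auto intro: empty_imp_negligible\<close>)
  then show "(LINT \<xi>:{0<..y}|lebesgue. f \<xi>) = integral {0..y} f"
    using set_lebesgue_integral_eq_integral(2)[OF assms] by simp
qed

lemma set_integrable_Ioc_subset: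
  fixes f :: "real \<Rightarrow> real"
  assumes "set_integrable lebesgue {0<..Y} f" "y \<le> Y"
  shows "set_integrable lebesgue {0<..y} f"
  by (rule set_integrable_subset[OF assms(1)]) (use assms(2) in auto)

lemma set_integrable_bounded_Ioc:
  fixes f :: "real \<Rightarrow> real"
  assumes "f \<in> borel_measurable (lebesgue_on {0<..y})"
    and "\<And>x. x \<in> {0<..y} \<Longrightarrow> \<bar>f x\<bar> \<le> B"
  shows "set_integrable lebesgue {0<..y} f"
  by (rule measurable_bounded_by_integrable_imp_absolutely_integrable[where g="\<lambda>_. B"])
     (use assms in \<open>auto intro!: integrable_on_const bounded_set_imp_lmeasurable\<close>)

text \<open>Compare with the antiderivative of the majorant. It is applied with \<open>k = 0\<close>
  to means and with \<open>k + 1 = l + m\<close> to the weighted integral of the equation.\<close>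

lemma set_LINT_Ioc_bound:
  fixes f :: "real \<Rightarrow> real"
  assumes "set_integrable lebesgue {0<..y} f" "0 < y"
    and "\<And>x. x \<in> {0<..y} \<Longrightarrow> \<bar>f x\<bar> \<le> C * x ^ Suc k"
  shows "\<bar>LINT x:{0<..y}|lebesgue. f x\<bar> \<le> C * y ^ (k + 2) / real (k + 2)"
proof -
  have hi: "((\<lambda>x. C * x ^ Suc k) has_integral
      C * y ^ (k + 2) / real (k + 2) - C * 0 ^ (k + 2) / real (k + 2)) {0..y}"
  proof (rule fundamental_theorem_of_calculus)
    fix x
    have "((\<lambda>x. C / real (k + 2) * x ^ (k + 2)) has_real_derivative C * x ^ Suc k)
        (at x within {0..y})"
      using DERIV_cmult[OF DERIV_pow[of "k + 2" x "{0..y}"], of "C / real (k + 2)"]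
      by (simp del: of_nat_add)
    then show "((\<lambda>x. C * x ^ (k + 2) / real (k + 2)) has_vector_derivative C * x ^ Suc k)
        (at x within {0..y})"
      by (simp add: has_real_derivative_iff_has_vector_derivative)
  qed (use assms(2) in simp)
  have nn: "\<bar>f x\<bar> \<le> C * x ^ Suc k" if "x \<in> {0<..y}" for x
    using assms(3)[OF that] .
  have "norm (integral {0<..y} f) \<le> integral {0<..y} (\<lambda>x. C * x ^ Suc k)"
  proof (rule integral_norm_bound_integral)
    show "f integrable_on {0<..y}"
      using set_lebesgue_integral_eq_integral(1)[OF assms(1)] .
    show "(\<lambda>x. C * x ^ Suc k) integrable_on {0<..y}"
      by (rule integrable_spike_set[OF has_integral_integrable[OF hi]])
         (auto intro: empty_imp_negligible)
  qed (use nn in auto)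
  also have "\<dots> = integral {0..y} (\<lambda>x. C * x ^ Suc k)"
    by (rule integral_spike_set) (auto intro: empty_imp_negligible)
  also have "\<dots> = C * y ^ (k + 2) / real (k + 2)"
    using integral_unique[OF hi] by simp
  finally show ?thesis
    using set_lebesgue_integral_eq_integral(2)[OF assms(1)] by simp
qed

lemma continuous_on_set_LINT_Ioc:
  fixes f :: "real \<Rightarrow> real"
  assumes "set_integrable lebesgue {0<..Y} f"
  shows "continuous_on {0<..Y} (\<lambda>y. LINT \<xi>:{0<..y}|lebesgue. f \<xi>)"
proof -
  have "continuous_on {0<..Y} (\<lambda>y. integral {0..y} f)"
    by (rule continuous_on_subset[OF indefinite_integral_continuous_1])
       (use set_LINT_Ioc(1)[OF assms] in auto)
  then show ?thesis
    by (rule continuous_on_eq)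
       (use set_LINT_Ioc(2)[OF set_integrable_Ioc_subset[OF assms]] in auto)
qed

section \<open>The ball in the weighted space, and means of its elements\<close>

text \<open>A pointwise description that replaces the supremum from here on; \<open>0 < Y\<close>
  makes the supremum range over a nonempty set.\<close>

lemma X_ball_iff:
  assumes "0 < Y"
  shows "r \<in> X_ball Y M \<longleftrightarrow> r \<in> extensional {0<..Y} \<and> continuous_on {0<..Y} r \<and>
    (\<forall>y\<in>{0<..Y}. \<bar>r y\<bar> \<le> M * y)"
proof -
  have eq: "(\<forall>y\<in>{0<..Y}. \<bar>r y / y\<bar> \<le> M) \<longleftrightarrow> (\<forall>y\<in>{0<..Y}. \<bar>r y\<bar> \<le> M * y)"
    by (auto simp: abs_divide pos_divide_le_eq)
  have "bdd_above ((\<lambda>y. \<bar>r y / y\<bar>) ` {0<..Y}) \<and> X_norm Y r \<le> M \<longleftrightarrow>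
      (\<forall>y\<in>{0<..Y}. \<bar>r y / y\<bar> \<le> M)"
    using assms unfolding X_norm_def
    by (metis (mono_tags, lifting) bdd_aboveI2 cSUP_le_iff greaterThanAtMost_empty_iff)
  with eq show ?thesis
    unfolding X_ball_def X_space_def by auto
qed

text \<open>The only way in which \<open>F2\<close> depends on \<open>r\<close> nonlocally.\<close>

definition mean :: "(real \<Rightarrow> real) \<Rightarrow> real \<Rightarrow> real" where
  "mean r y = (LINT \<xi>:{0<..y}|lebesgue. r \<xi>) / y"

lemma set_integrable_X_ball:
  assumes "0 < Y" "0 \<le> M" "r \<in> X_ball Y M" "y \<in> {0<..Y}"
  shows "set_integrable lebesgue {0<..y} r"
proof (rule set_integrable_bounded_Ioc[where B="M * Y"])
  have "continuous_on {0<..y} r"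
    using assms by (auto simp: X_ball_iff intro: continuous_on_subset)
  then show "r \<in> borel_measurable (lebesgue_on {0<..y})"
    by (rule continuous_imp_measurable_on_sets_lebesgue) auto
  fix x assume "x \<in> {0<..y}"
  then have "\<bar>r x\<bar> \<le> M * x" and "x \<le> Y" using assms by (auto simp: X_ball_iff)
  moreover have "M * x \<le> M * Y" using \<open>x \<le> Y\<close> assms(2) by (rule mult_left_mono)
  ultimately show "\<bar>r x\<bar> \<le> M * Y" by linarith
qed

lemma mean_bound:
  assumes "set_integrable lebesgue {0<..y} r" "0 < y"
    and "\<And>x. x \<in> {0<..y} \<Longrightarrow> \<bar>r x\<bar> \<le> C * x"
  shows "\<bar>mean r y\<bar> \<le> C * y / 2"
proof -
  have "\<bar>LINT x:{0<..y}|lebesgue. r x\<bar> \<le> C * y ^ 2 / 2"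
    using set_LINT_Ioc_bound[OF assms(1,2), of C 0] assms(3) by (simp add: numeral_2_eq_2)
  with assms(2) show ?thesis
    by (simp add: mean_def divide_simps abs_divide power2_eq_square ac_simps)
qed

lemma mean_diff:
  assumes "set_integrable lebesgue {0<..y} r" "set_integrable lebesgue {0<..y} s"
  shows "mean (\<lambda>x. r x - s x) y = mean r y - mean s y"
  using assms by (simp add: mean_def set_integral_diff diff_divide_distrib)

lemma continuous_on_mean:
  assumes "set_integrable lebesgue {0<..Y} r"
  shows "continuous_on {0<..Y} (mean r)"
  unfolding mean_def
  by (intro continuous_intros continuous_on_set_LINT_Ioc[OF assms]) auto

lemma F2_denom_mean:
  assumes "m \<ge> 1"
  shows "F2_denom l m r y = sqrt m * (mean r y + sqrt (real l / real m))"
  using assms by (simp add: F2_denom_def mean_def real_sqrt_divide field_simps)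

text \<open>A factor \<open>sqrt m\<close> cancels between numerator and denominator, so
  \<open>F2\<close> becomes a function of the two real numbers \<open>r y\<close> and
  \<open>mean r y\<close>, to which real-variable estimates apply.\<close>

lemma F2_mean:
  assumes "m \<ge> 1"
  shows "F2 l m r y = - sqrt (real l * real m) * (1 + (r y + sqrt (real l / real m))\<^sup>2) *
    (mean r y / (mean r y + sqrt (real l / real m)))"
  using assms by (simp add: F2_def F2_denom_mean) (simp add: mean_def)

section \<open>Lipschitz estimates for the nonlinear terms\<close>

text \<open>\<open>F1\<close> has only quadratic and cubic terms, so its Lipschitz constant vanishes
  at the origin. Here \<open>\<psi>\<close> is \<open>F2\<close> as a function of value and mean:
  its derivative in \<rho> vanishes at the origin because of the factor \<open>a\<close>, and its
  derivative in \<open>a\<close> there is -(l + m), the one constant that cannot be made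
  small.\<close>

lemma local_lipschitz_estimates:
  fixes l m :: nat and \<epsilon> :: real
  defines "c \<equiv> sqrt (real l / real m)"
  defines "\<psi> \<equiv> \<lambda>\<rho> a. - sqrt (real l * real m) * (1 + (\<rho> + c)\<^sup>2) * (a / (a + c))"
  assumes lm: "l \<ge> 1" "m \<ge> 1" and "\<epsilon> > 0"
  obtains \<delta> where "0 < \<delta>" "\<delta> \<le> 1"
    "\<And>a. \<bar>a\<bar> \<le> \<delta> \<Longrightarrow> a + c \<noteq> 0"
    "\<And>\<rho> \<sigma>. \<bar>\<rho>\<bar> \<le> \<delta> \<Longrightarrow> \<bar>\<sigma>\<bar> \<le> \<delta> \<Longrightarrow> \<bar>F1 l m \<rho> - F1 l m \<sigma>\<bar> \<le> \<epsilon> * \<bar>\<rho> - \<sigma>\<bar>"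
    "\<And>\<rho> \<sigma> a b. \<bar>\<rho>\<bar> \<le> \<delta> \<Longrightarrow> \<bar>\<sigma>\<bar> \<le> \<delta> \<Longrightarrow> \<bar>a\<bar> \<le> \<delta> \<Longrightarrow> \<bar>b\<bar> \<le> \<delta> \<Longrightarrow>
      \<bar>\<psi> \<rho> a - \<psi> \<sigma> b\<bar> \<le> \<epsilon> * \<bar>\<rho> - \<sigma>\<bar> + (real (l + m) + \<epsilon>) * \<bar>a - b\<bar>"
proof -
  define k where "k = sqrt (real l * real m)"
  have c: "c > 0" using lm by (simp add: c_def)
  \<comment> \<open>This is the size of the derivative of \<open>\<psi>\<close> in \<open>a\<close>
    at the origin: k = m c, and m (1 + c^2) = m + l.\<close>
  have k: "k * (1 + c\<^sup>2) / c = real (l + m)"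
  proof -
    have "k = real m * c"
      using lm by (simp add: k_def c_def real_sqrt_mult real_sqrt_divide field_simps)
    moreover have "real m * (1 + c\<^sup>2) = real (l + m)"
      using lm by (simp add: c_def field_simps)
    ultimately show ?thesis using c by (simp add: field_simps)
  qed
  \<comment> \<open>The functions \<open>f\<close>, \<open>g\<close>, \<open>h\<close> are, up to
    sign, the cofactors of the increments in the differences of \<open>F1\<close> and
    \<open>\<psi>\<close>. They are continuous at the origin with values 0, 0 and l + m, which
    yields the constants by continuity alone.\<close>
  define f where "f = (\<lambda>(\<rho>, \<sigma>). real m * (\<rho>\<^sup>2 + \<rho> * \<sigma> + \<sigma>\<^sup>2) + 2 * k * (\<rho> + \<sigma>))"
  define g where "g = (\<lambda>(\<rho>, \<sigma>, a). k * (\<rho> + \<sigma> + 2 * c) * (a / (a + c)))"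
  define h where "h = (\<lambda>(\<sigma>, a, b). k * (1 + (\<sigma> + c)\<^sup>2) * (c / ((a + c) * (b + c))))"
  have "(f \<longlongrightarrow> f (0, 0)) (nhds (0, 0))"
    unfolding f_def case_prod_unfold by (intro tendsto_intros filterlim_ident) 
  moreover have "f (0, 0) = 0" by (simp add: f_def)
  ultimately have "\<forall>\<^sub>F p in nhds (0, 0). \<bar>f p\<bar> < \<epsilon>"
    using \<open>\<epsilon> > 0\<close> by (auto simp: tendsto_iff)
  then obtain d1 where d1: "d1 > 0" "\<And>p. dist p (0, 0) < d1 \<Longrightarrow> \<bar>f p\<bar> < \<epsilon>"
    unfolding eventually_nhds_metric by blast
  have "(g \<longlongrightarrow> g (0, 0, 0)) (nhds (0, 0, 0))"
    unfolding g_def case_prod_unfold using c by (intro tendsto_intros filterlim_ident) auto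
  moreover have "g (0, 0, 0) = 0" by (simp add: g_def)
  ultimately have "\<forall>\<^sub>F p in nhds (0, 0, 0). \<bar>g p\<bar> < \<epsilon>"
    using \<open>\<epsilon> > 0\<close> by (auto simp: tendsto_iff)
  then obtain d2 where d2: "d2 > 0" "\<And>p. dist p (0, 0, 0) < d2 \<Longrightarrow> \<bar>g p\<bar> < \<epsilon>"
    unfolding eventually_nhds_metric by blast
  have "(h \<longlongrightarrow> h (0, 0, 0)) (nhds (0, 0, 0))"
    unfolding h_def case_prod_unfold using c by (intro tendsto_intros filterlim_ident) auto
  moreover have "h (0, 0, 0) = real (l + m)" using c by (simp add: h_def k[symmetric] del: of_nat_add)
  ultimately have "\<forall>\<^sub>F p in nhds (0, 0, 0). \<bar>h p - real (l + m)\<bar> < \<epsilon>"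
    using \<open>\<epsilon> > 0\<close> by (auto simp: tendsto_iff dist_real_def)
  then obtain d3 where d3: "d3 > 0" "\<And>p. dist p (0, 0, 0) < d3 \<Longrightarrow> \<bar>h p - real (l + m)\<bar> < \<epsilon>"
    unfolding eventually_nhds_metric by blast
  \<comment> \<open>The bound \<open>c / 2\<close> keeps \<open>a + c\<close> positive. The division
    by 4 keeps pairs and triples of numbers of size at most \<delta> strictly inside the
    neighbourhoods, since their distance from the origin is at most 3 \<delta>.\<close>
  define \<delta> where "\<delta> = min 1 (min (c / 2) (min d1 (min d2 d3) / 4))"
  have \<delta>: "\<delta> \<le> 1" "\<delta> \<le> c / 2" "\<delta> \<le> d1 / 4" "\<delta> \<le> d2 / 4" "\<delta> \<le> d3 / 4" "0 < \<delta>"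
    using c d1 d2 d3 by (auto simp: \<delta>_def)
  have pair: "dist (x, y) (0::real, 0) \<le> \<bar>x\<bar> + \<bar>y\<bar>" for x y :: real
    using norm_Pair_le[of x y] by (simp add: zero_prod_def[symmetric])
  have triple: "dist (x, y, z) (0::real, 0::real, 0::real) \<le> \<bar>x\<bar> + \<bar>y\<bar> + \<bar>z\<bar>" for x y z :: real
    using norm_Pair_le[of x "(y, z)"] norm_Pair_le[of y z] by (simp add: zero_prod_def[symmetric])
  show thesis
  proof
    show "0 < \<delta>" "\<delta> \<le> 1" using \<delta> by simp_all
    show nz: "a + c \<noteq> 0" if "\<bar>a\<bar> \<le> \<delta>" for a using that \<delta> c by linarith
    show "\<bar>F1 l m \<rho> - F1 l m \<sigma>\<bar> \<le> \<epsilon> * \<bar>\<rho> - \<sigma>\<bar>" if "\<bar>\<rho>\<bar> \<le> \<delta>" "\<bar>\<sigma>\<bar> \<le> \<delta>" for \<rho> \<sigma>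
    proof -
      have "\<bar>f (\<rho>, \<sigma>)\<bar> \<le> \<epsilon>"
        using d1(2)[of "(\<rho>, \<sigma>)"] pair[of \<rho> \<sigma>] that \<delta> by simp
      moreover have "F1 l m \<rho> - F1 l m \<sigma> = - f (\<rho>, \<sigma>) * (\<rho> - \<sigma>)"
        unfolding F1_def f_def k_def[symmetric] by (simp add: power2_eq_square algebra_simps)
      ultimately show ?thesis by (simp add: abs_mult mult_right_mono)
    qed
    show "\<bar>\<psi> \<rho> a - \<psi> \<sigma> b\<bar> \<le> \<epsilon> * \<bar>\<rho> - \<sigma>\<bar> + (real (l + m) + \<epsilon>) * \<bar>a - b\<bar>"
      if "\<bar>\<rho>\<bar> \<le> \<delta>" "\<bar>\<sigma>\<bar> \<le> \<delta>" "\<bar>a\<bar> \<le> \<delta>" "\<bar>b\<bar> \<le> \<delta>" for \<rho> \<sigma> a b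
    proof -
      have g: "\<bar>g (\<rho>, \<sigma>, a)\<bar> \<le> \<epsilon>"
        using d2(2)[of "(\<rho>, \<sigma>, a)"] triple[of \<rho> \<sigma> a] that \<delta> by simp
      have h: "\<bar>h (\<sigma>, a, b)\<bar> \<le> real (l + m) + \<epsilon>"
        using d3(2)[of "(\<sigma>, a, b)"] triple[of \<sigma> a b] that \<delta> by simp
      have nza: "a + c \<noteq> 0" and nzb: "b + c \<noteq> 0" using nz that by auto
      have ab: "a / (a + c) - b / (b + c) = c / ((a + c) * (b + c)) * (a - b)"
        using nza nzb by (simp add: divide_simps) (simp add: algebra_simps)
      \<comment> \<open>Change \<rho> to \<sigma> with the quotient \<open>A\<close> fixed, then
        \<open>A\<close> to \<open>B\<close> with \<sigma> fixed.\<close>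
      have split: "- k * (1 + (\<rho> + c)\<^sup>2) * A - - k * (1 + (\<sigma> + c)\<^sup>2) * B =
          - (k * (\<rho> + \<sigma> + 2 * c) * A * (\<rho> - \<sigma>) + k * (1 + (\<sigma> + c)\<^sup>2) * (A - B))" for A B
        by (simp add: power2_eq_square algebra_simps)
      have "\<psi> \<rho> a - \<psi> \<sigma> b = - (k * (\<rho> + \<sigma> + 2 * c) * (a / (a + c)) * (\<rho> - \<sigma>)
          + k * (1 + (\<sigma> + c)\<^sup>2) * (a / (a + c) - b / (b + c)))"
        unfolding \<psi>_def k_def[symmetric] by (rule split)
      also have "\<dots> = - (g (\<rho>, \<sigma>, a) * (\<rho> - \<sigma>) + h (\<sigma>, a, b) * (a - b))"
        unfolding ab g_def h_def by simp
      finally have "\<bar>\<psi> \<rho> a - \<psi> \<sigma> b\<bar> \<le> \<bar>g (\<rho>, \<sigma>, a)\<bar> * \<bar>\<rho> - \<sigma>\<bar> + \<bar>h (\<sigma>, a, b)\<bar> * \<bar>a - b\<bar>"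
        by (metis abs_minus_cancel abs_mult abs_triangle_ineq)
      also have "\<dots> \<le> \<epsilon> * \<bar>\<rho> - \<sigma>\<bar> + (real (l + m) + \<epsilon>) * \<bar>a - b\<bar>"
        using g h by (intro add_mono mult_right_mono) auto
      finally show ?thesis .
    qed
  qed
qed

text \<open>The derivative is continuous, hence bounded, on the compact interval [-1,1]. This range
  is enough because arguments will be at most \<delta> \<le> 1.\<close>

lemma powr_three_halves_lipschitz:
  fixes c :: real
  obtains L where "0 \<le> L"
    "\<And>\<rho> \<sigma>. \<bar>\<rho>\<bar> \<le> 1 \<Longrightarrow> \<bar>\<sigma>\<bar> \<le> 1 \<Longrightarrow>
      \<bar>(1 + (\<rho> + c)\<^sup>2) powr (3/2) - (1 + (\<sigma> + c)\<^sup>2) powr (3/2)\<bar> \<le> L * \<bar>\<rho> - \<sigma>\<bar>"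
proof -
  define f' where "f' = (\<lambda>x. (3/2) * (1 + (x + c)\<^sup>2) powr (1/2) * (2 * (x + c)))"
  have pos: "1 + (x + c)\<^sup>2 > 0" for x :: real by (simp add: add_pos_nonneg)
  have der: "((\<lambda>x. (1 + (x + c)\<^sup>2) powr (3/2)) has_real_derivative f' x) (at x within {-1..1})" for x
    unfolding f'_def using pos[of x] by (auto intro!: derivative_eq_intros)
  have "continuous_on {-1..1} f'"
    unfolding f'_def using pos by (intro continuous_intros) (simp add: order_less_imp_not_eq2)
  then have "bounded (f' ` {-1..1})"
    by (intro compact_imp_bounded compact_continuous_image) auto
  then obtain L where L: "\<And>x. x \<in> {-1..1} \<Longrightarrow> norm (f' x) \<le> L"
    unfolding bounded_iff by (metis image_eqI)
  have "norm (f' 0) \<le> L" by (rule L) auto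
  then have "0 \<le> L" using norm_ge_zero[of "f' 0"] by linarith
  then show thesis
  proof (rule that)
    fix \<rho> \<sigma> :: real assume "\<bar>\<rho>\<bar> \<le> 1" "\<bar>\<sigma>\<bar> \<le> 1"
    then show "\<bar>(1 + (\<rho> + c)\<^sup>2) powr (3/2) - (1 + (\<sigma> + c)\<^sup>2) powr (3/2)\<bar> \<le> L * \<bar>\<rho> - \<sigma>\<bar>"
      using field_differentiable_bound[OF _ der L, of \<rho> \<sigma>] by (simp add: abs_le_iff)
  qed
qed

section \<open>Fixed points of contractions of the ball\<close>

lemma zero_in_X_ball:
  assumes "0 < Y" "0 \<le> M"
  shows "(\<lambda>_\<in>{0<..Y}. 0) \<in> X_ball Y M"
proof -
  have "continuous_on {0<..Y} (\<lambda>_\<in>{0<..Y}. 0 :: real)"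
    by (rule continuous_on_eq[of _ "\<lambda>_. 0"]) auto
  then show ?thesis
    unfolding X_ball_iff[OF assms(1)] using assms
    by (intro conjI restrict_extensional) auto
qed

text \<open>Banach's fixed point argument with ratio 1/2. Distances are expressed by pointwise
  bounds \<open>d * x\<close>, and dividing by x turns convergence in the weighted norm into uniform
  convergence.\<close>

lemma X_ball_contraction_fixed_point:
  assumes "0 < Y" "0 \<le> M"
    and ball: "\<And>r. r \<in> X_ball Y M \<Longrightarrow> \<Phi> r \<in> X_ball Y M"
    and contr: "\<And>r s d x. r \<in> X_ball Y M \<Longrightarrow> s \<in> X_ball Y M \<Longrightarrow>
      (\<And>x. x \<in> {0<..Y} \<Longrightarrow> \<bar>r x - s x\<bar> \<le> d * x) \<Longrightarrow> x \<in> {0<..Y} \<Longrightarrow>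
      \<bar>\<Phi> r x - \<Phi> s x\<bar> \<le> d / 2 * x"
  shows "\<exists>!r. r \<in> X_ball Y M \<and> \<Phi> r = r"
proof -
  have bound: "\<bar>r x\<bar> \<le> M * x" if "r \<in> X_ball Y M" "x \<in> {0<..Y}" for r x
    using that assms(1) by (simp add: X_ball_iff)
  define u where "u k = (\<Phi> ^^ k) (\<lambda>_\<in>{0<..Y}. 0)" for k
  have u0: "u 0 x = 0" if "x \<in> {0<..Y}" for x using that by (simp add: u_def)
  have uS: "u (Suc k) = \<Phi> (u k)" for k by (simp add: u_def)
  have u: "u k \<in> X_ball Y M" for k
  proof (induction k)
    case 0
    show ?case using zero_in_X_ball[OF assms(1,2)] by (simp only: u_def funpow_0)
  qed (simp add: uS ball)
  \<comment> \<open>The iteration starts at zero, so the first increment is \<open>u 1\<close>,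
    which the ball bounds by \<open>M * x\<close>.\<close>
  have step: "\<bar>u (Suc k) x - u k x\<bar> \<le> M * (1/2) ^ k * x" if "x \<in> {0<..Y}" for k x
    using that
  proof (induction k arbitrary: x)
    case 0
    then show ?case using bound[OF u[of 1]] u0 by simp
  next
    case (Suc k)
    then show ?case using contr[OF u[of "Suc k"] u[of k] Suc.IH, of x] by (simp add: uS)
  qed
  \<comment> \<open>The limit of \<open>u k x / x\<close>, obtained as a telescoping series to which
    the Weierstrass test applies.\<close>
  define v where "v x = (\<Sum>i. (u (Suc i) x - u i x) / x)" for x
  have series: "uniform_limit {0<..Y} (\<lambda>k x. \<Sum>i<k. (u (Suc i) x - u i x) / x) v sequentially"
    unfolding v_def
  proof (rule Weierstrass_m_test)
    fix k x assume "x \<in> {0<..Y}"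
    then show "norm ((u (Suc k) x - u k x) / x) \<le> M * (1/2) ^ k"
      using step[of x k] by (simp add: abs_divide pos_divide_le_eq)
  qed (simp add: summable_mult)
  have telescope: "(\<Sum>i<k. (u (Suc i) x - u i x) / x) = u k x / x" if "x \<in> {0<..Y}" for k x
    using u0[OF that] sum_lessThan_telescope[of "\<lambda>i. u i x" k]
    by (simp add: sum_divide_distrib[symmetric])
  have v: "uniform_limit {0<..Y} (\<lambda>k x. u k x / x) v sequentially"
    by (rule uniform_limit_cong'[THEN iffD1, OF _ _ series]) (simp_all only: telescope)
  define q where "q = (\<lambda>x\<in>{0<..Y}. v x * x)"
  have q: "q \<in> X_ball Y M"
  proof -
    have "continuous_on {0<..Y} v"
      using v u assms(1)
      by (intro uniform_limit_theorem[OF _ v])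
         (auto intro!: always_eventually continuous_intros simp: X_ball_iff)
    then have "continuous_on {0<..Y} (\<lambda>x. v x * x)" by (intro continuous_intros)
    then have "continuous_on {0<..Y} q" by (rule continuous_on_eq) (simp add: q_def)
    moreover have "\<bar>v x\<bar> \<le> M" if "x \<in> {0<..Y}" for x
    proof (rule LIMSEQ_le_const2)
      show "(\<lambda>k. \<bar>u k x / x\<bar>) \<longlonglongrightarrow> \<bar>v x\<bar>"
        using tendsto_uniform_limitI[OF v that] by (rule tendsto_rabs)
      show "\<exists>N. \<forall>n\<ge>N. \<bar>u n x / x\<bar> \<le> M"
        using bound[OF u that] that by (auto simp: abs_divide pos_divide_le_eq)
    qed
    ultimately show ?thesis
      using assms(1) by (auto simp: X_ball_iff q_def abs_mult mult_right_mono)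
  qed
  have approx: "\<exists>N. \<forall>k\<ge>N. \<forall>x\<in>{0<..Y}. \<bar>u k x - q x\<bar> \<le> e * x" if "e > 0" for e
  proof -
    obtain N where N: "\<And>k x. k \<ge> N \<Longrightarrow> x \<in> {0<..Y} \<Longrightarrow> \<bar>u k x / x - v x\<bar> < e"
      using uniform_limitD[OF v \<open>e > 0\<close>] unfolding eventually_sequentially dist_real_def by blast
    have "\<bar>u k x - q x\<bar> \<le> e * x" if "k \<ge> N" "x \<in> {0<..Y}" for k x
    proof -
      have "\<bar>u k x - q x\<bar> = \<bar>u k x / x - v x\<bar> * x"
        using that(2) abs_mult[of "u k x / x - v x" x] by (simp add: q_def algebra_simps)
      also have "\<dots> \<le> e * x"
        using N[OF that] that(2) by (intro mult_right_mono) auto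
      finally show ?thesis .
    qed
    then show ?thesis by blast
  qed
  have "\<Phi> q = q"
  proof (rule extensionalityI[of _ "{0<..Y}"])
    fix x assume x: "x \<in> {0<..Y}"
    \<comment> \<open>Both terms are compared with the iterate \<open>\<Phi> (u k)\<close>: at the
      fixed point x the weighted tolerance \<open>e / (2 * x)\<close> gives errors e/4 and
      e/2.\<close>
    have "\<bar>\<Phi> q x - q x\<bar> \<le> e" if "e > 0" for e
    proof -
      have "e / (2 * x) > 0" using that x by simp
      from approx[OF this] obtain k where
        k: "\<And>j y. j \<ge> k \<Longrightarrow> y \<in> {0<..Y} \<Longrightarrow> \<bar>u j y - q y\<bar> \<le> e / (2 * x) * y" by blast
      have "\<bar>\<Phi> (u k) x - \<Phi> q x\<bar> \<le> e / (2 * x) / 2 * x"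
        by (rule contr[OF u q _ x]) (use k in blast)
      moreover have "\<bar>\<Phi> (u k) x - q x\<bar> \<le> e / (2 * x) * x"
        using k[of "Suc k" x] x by (simp add: uS)
      moreover have "e / (2 * x) / 2 * x = e / 4" "e / (2 * x) * x = e / 2" using x by auto
      ultimately have "\<bar>\<Phi> (u k) x - \<Phi> q x\<bar> \<le> e / 4" "\<bar>\<Phi> (u k) x - q x\<bar> \<le> e / 2"
        by (simp_all only:)
      then show ?thesis using that by linarith
    qed
    then have "\<bar>\<Phi> q x - q x\<bar> \<le> 0" by (rule field_le_epsilon) simp
    then show "\<Phi> q x = q x" by simp
  qed (use q ball[OF q] assms(1) in \<open>auto simp: X_ball_iff\<close>)
  moreover have "r = s" if r: "r \<in> X_ball Y M" "\<Phi> r = r" and s: "s \<in> X_ball Y M" "\<Phi> s = s" for r s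
  proof (rule extensionalityI[of _ "{0<..Y}"])
    \<comment> \<open>Two elements of the ball are at distance at most 2 M, and each application of
      \<open>\<Phi>\<close>, which fixes both, halves the bound.\<close>
    have close: "\<bar>r x - s x\<bar> \<le> 2 * M * (1/2) ^ k * x" if "x \<in> {0<..Y}" for k x
      using that
    proof (induction k arbitrary: x)
      case 0
      then show ?case using bound[OF r(1), of x] bound[OF s(1), of x] by simp
    next
      case (Suc k)
      then show ?case using contr[OF r(1) s(1) Suc.IH, of x] r(2) s(2) by simp
    qed
    show "r x = s x" if "x \<in> {0<..Y}" for x
    proof -
      have "(\<lambda>k. 2 * M * (1/2) ^ k * x) \<longlonglongrightarrow> 2 * M * 0 * x"
        by (intro tendsto_mult tendsto_const LIMSEQ_power_zero) simp
      then have "\<bar>r x - s x\<bar> \<le> 2 * M * 0 * x"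
        by (rule LIMSEQ_le_const) (use close[OF that] in blast)
      then show ?thesis by simp
    qed
  qed (use r s assms(1) in \<open>auto simp: X_ball_iff\<close>)
  ultimately show ?thesis using q by blast
qed

section \<open>The right-hand side on a small ball\<close>

definition rhs ::
    "nat \<Rightarrow> nat \<Rightarrow> nat \<Rightarrow> (real \<Rightarrow> real) \<Rightarrow> (real \<Rightarrow> real) \<Rightarrow> real \<Rightarrow> real" where
  "rhs l m n H r y = F1 l m (r y) + F2 l m r y + F3 l m n H (r y) y"

text \<open>These two terms are kept apart from \<open>F3\<close> because they are continuous even
  when \<open>H\<close> is merely measurable; the result serves both measurability and continuity of
  \<open>rhs\<close>.\<close>

lemma continuous_on_F1_F2:
  assumes "m \<ge> 1" "0 < Y" "0 \<le> M" "r \<in> X_ball Y M"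
    and "\<And>y. y \<in> {0<..Y} \<Longrightarrow> F2_denom l m r y \<noteq> 0"
  shows "continuous_on {0<..Y} (\<lambda>y. F1 l m (r y) + F2 l m r y)"
proof -
  have "set_integrable lebesgue {0<..Y} r"
    using set_integrable_X_ball assms by simp
  note continuous_on_mean[OF this]
  moreover have "continuous_on {0<..Y} r" using assms by (simp add: X_ball_iff)
  ultimately show ?thesis
    using assms(5) unfolding F2_mean[OF assms(1)] F2_denom_mean[OF assms(1)] F1_def
    by (intro continuous_intros) auto
qed

lemma borel_measurable_rhs:
  assumes "m \<ge> 1" "0 < Y" "0 \<le> M" "r \<in> X_ball Y M"
    and "\<And>y. y \<in> {0<..Y} \<Longrightarrow> F2_denom l m r y \<noteq> 0"
    and "H \<in> borel_measurable (lebesgue_on {0<..Y})"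
  shows "rhs l m n H r \<in> borel_measurable (lebesgue_on {0<..Y})"
proof -
  have "r \<in> borel_measurable (lebesgue_on {0<..Y})"
    using assms by (intro continuous_imp_measurable_on_sets_lebesgue) (auto simp: X_ball_iff)
  moreover have "(\<lambda>y. y) \<in> borel_measurable (lebesgue_on {0<..Y})"
    by (intro continuous_imp_measurable_on_sets_lebesgue) auto
  moreover have "(\<lambda>y. F1 l m (r y) + F2 l m r y) \<in> borel_measurable (lebesgue_on {0<..Y})"
    by (intro continuous_imp_measurable_on_sets_lebesgue continuous_on_F1_F2[OF assms(1-5)]) auto
  ultimately show ?thesis
    using assms(6) unfolding rhs_def F3_def by measurable
qed

text \<open>The factor \<open>real (l + m + 1)\<close> is the one that the weighted integration
  divides out, leaving the ratio 1/2 and the radius \<open>M\<close> for the integral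
  operator.\<close>

lemma rhs_contraction:
  fixes Y\<^sub>0 K :: real
  assumes lm: "l \<ge> 1" "m \<ge> 1" and n: "n = l + m + 2" and "Y\<^sub>0 > 0"
    and K: "\<And>y. y \<in> {0..Y\<^sub>0} \<Longrightarrow> \<bar>H y\<bar> \<le> K"
  obtains M Y where "0 < M" "0 < Y" "Y \<le> Y\<^sub>0"
    "\<And>r y. r \<in> X_ball Y M \<Longrightarrow> y \<in> {0<..Y} \<Longrightarrow> F2_denom l m r y \<noteq> 0"
    "\<And>r s d y. r \<in> X_ball Y M \<Longrightarrow> s \<in> X_ball Y M \<Longrightarrow>
      (\<And>x. x \<in> {0<..Y} \<Longrightarrow> \<bar>r x - s x\<bar> \<le> d * x) \<Longrightarrow> y \<in> {0<..Y} \<Longrightarrow>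
      \<bar>rhs l m n H r y - rhs l m n H s y\<bar> \<le> real (l + m + 1) * (d / 2) * y"
    "\<And>r y. r \<in> X_ball Y M \<Longrightarrow> y \<in> {0<..Y} \<Longrightarrow>
      \<bar>rhs l m n H r y\<bar> \<le> real (l + m + 1) * M * y"
proof -
  define c where "c = sqrt (real l / real m)"
  define P where "P \<rho> = (1 + (\<rho> + c)\<^sup>2) powr (3/2)" for \<rho>
  \<comment> \<open>The value 1/10 balances the budget. Values of \<open>r\<close> contribute 1/10
    from \<open>F1\<close>, 1/10 from \<open>F2\<close> and 1/4 from \<open>F3\<close>, in all 9/20;
    the mean contributes (l + m + 1/10)/2. The sum is exactly (l + m + 1)/2.\<close>
  obtain \<delta> where \<delta>: "0 < \<delta>" "\<delta> \<le> 1"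
    and denom: "\<And>a. \<bar>a\<bar> \<le> \<delta> \<Longrightarrow> a + c \<noteq> 0"
    and L1: "\<And>\<rho> \<sigma>. \<bar>\<rho>\<bar> \<le> \<delta> \<Longrightarrow> \<bar>\<sigma>\<bar> \<le> \<delta> \<Longrightarrow> \<bar>F1 l m \<rho> - F1 l m \<sigma>\<bar> \<le> 1/10 * \<bar>\<rho> - \<sigma>\<bar>"
    and L2: "\<And>\<rho> \<sigma> a b. \<bar>\<rho>\<bar> \<le> \<delta> \<Longrightarrow> \<bar>\<sigma>\<bar> \<le> \<delta> \<Longrightarrow> \<bar>a\<bar> \<le> \<delta> \<Longrightarrow> \<bar>b\<bar> \<le> \<delta> \<Longrightarrow>
      \<bar>- sqrt (real l * real m) * (1 + (\<rho> + c)\<^sup>2) * (a / (a + c)) -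
       - sqrt (real l * real m) * (1 + (\<sigma> + c)\<^sup>2) * (b / (b + c))\<bar>
      \<le> 1/10 * \<bar>\<rho> - \<sigma>\<bar> + (real (l + m) + 1/10) * \<bar>a - b\<bar>"
    using local_lipschitz_estimates[OF lm, of "1/10"] unfolding c_def by auto
  obtain L where L: "0 \<le> L"
    and L3: "\<And>\<rho> \<sigma>. \<bar>\<rho>\<bar> \<le> 1 \<Longrightarrow> \<bar>\<sigma>\<bar> \<le> 1 \<Longrightarrow> \<bar>P \<rho> - P \<sigma>\<bar> \<le> L * \<bar>\<rho> - \<sigma>\<bar>"
    using powr_three_halves_lipschitz[of c] unfolding P_def by blast
  have "\<bar>H 0\<bar> \<le> K" using K assms(4) by simp
  then have K0: "0 \<le> K" by linarith
  define A where "A = (real n - 1) * K"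
  have A: "0 \<le> A" using K0 n by (simp add: A_def)
  \<comment> \<open>At r = 0 only \<open>F3\<close> survives, and it is bounded by
    \<open>A * P 0 * y\<close>. The summand 1 makes \<open>M\<close> positive.\<close>
  define M where "M = A * P 0 + 1"
  have M: "M \<ge> 1" using A by (simp add: M_def P_def)
  \<comment> \<open>The bound \<open>\<delta> / M\<close> brings the whole ball into the range of
    the local estimates; the last bound gives \<open>A * L * Y \<le> 1/4\<close>.\<close>
  define Y where "Y = min Y\<^sub>0 (min (\<delta> / M) (1 / (4 * (A * L + 1))))"
  have AL: "0 \<le> A * L" using A L by simp
  have Y: "0 < Y" "Y \<le> Y\<^sub>0" "M * Y \<le> \<delta>" "A * L * Y \<le> 1/4"
  proof -
    show "0 < Y" "Y \<le> Y\<^sub>0" using assms(4) \<delta> M AL by (auto simp: Y_def)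
    have "Y \<le> \<delta> / M" by (simp add: Y_def)
    then show "M * Y \<le> \<delta>" using M by (simp add: field_simps)
    have "Y \<le> 1 / (4 * (A * L + 1))" by (simp add: Y_def)
    then have "4 * (A * L * Y + Y) \<le> 1" using AL by (simp add: field_simps)
    then show "A * L * Y \<le> 1/4" using \<open>0 < Y\<close> by simp
  qed
  have int: "set_integrable lebesgue {0<..y} r" if "r \<in> X_ball Y M" "y \<in> {0<..Y}" for r y
    by (rule set_integrable_X_ball[OF Y(1) _ that]) (use M in simp)
  have bound: "\<bar>r y\<bar> \<le> M * y" if "r \<in> X_ball Y M" "y \<in> {0<..Y}" for r y
    using that Y by (simp add: X_ball_iff)
  have My: "M * y \<le> \<delta>" if "y \<in> {0<..Y}" for y
  proof -
    have "M * y \<le> M * Y" using that M by (intro mult_left_mono) auto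
    then show ?thesis using Y by linarith
  qed
  have small: "\<bar>r y\<bar> \<le> \<delta>" "\<bar>mean r y\<bar> \<le> \<delta>" if "r \<in> X_ball Y M" "y \<in> {0<..Y}" for r y
  proof -
    show "\<bar>r y\<bar> \<le> \<delta>" using bound[OF that] My[OF that(2)] by linarith
    have "\<bar>mean r y\<bar> \<le> M * y / 2"
      by (rule mean_bound[OF int[OF that]]) (use bound[OF that(1)] that(2) in auto)
    then show "\<bar>mean r y\<bar> \<le> \<delta>" using My[OF that(2)] \<delta> by linarith
  qed
  have lip: "\<bar>rhs l m n H r y - rhs l m n H s y\<bar> \<le> real (l + m + 1) * (d / 2) * y"
    if r: "r \<in> X_ball Y M" and s: "s \<in> X_ball Y M"
      and d: "\<And>x. x \<in> {0<..Y} \<Longrightarrow> \<bar>r x - s x\<bar> \<le> d * x" and y: "y \<in> {0<..Y}" for r s d y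
  proof -
    define e where "e = \<bar>r y - s y\<bar>"
    have e: "e \<le> d * y" "0 \<le> e" using d[OF y] by (simp_all add: e_def)
    have me: "\<bar>mean r y - mean s y\<bar> \<le> d * y / 2"
      unfolding mean_diff[OF int[OF r y] int[OF s y], symmetric]
      by (rule mean_bound[OF set_integral_diff(1)[OF int[OF r y] int[OF s y]]])
         (use d y in auto)
    have f1: "\<bar>F1 l m (r y) - F1 l m (s y)\<bar> \<le> 1/10 * e"
      unfolding e_def by (rule L1) (use small r s y in auto)
    have "\<bar>F2 l m r y - F2 l m s y\<bar> \<le> 1/10 * e + (real (l + m) + 1/10) * \<bar>mean r y - mean s y\<bar>"
      unfolding F2_mean[OF lm(2)] c_def[symmetric] e_def
      by (rule L2) (use small r s y in auto)
    moreover have "(real (l + m) + 1/10) * \<bar>mean r y - mean s y\<bar> \<le> (real (l + m) + 1/10) * (d * y / 2)"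
      using me by (intro mult_left_mono) auto
    ultimately have f2: "\<bar>F2 l m r y - F2 l m s y\<bar> \<le> 1/10 * e + (real (l + m) + 1/10) * (d * y / 2)"
      by linarith
    have "F3 l m n H (r y) y - F3 l m n H (s y) y = (real n - 1) * H y * y * (P (r y) - P (s y))"
      unfolding F3_def P_def c_def by (simp add: algebra_simps)
    then have "\<bar>F3 l m n H (r y) y - F3 l m n H (s y) y\<bar>
        = ((real n - 1) * \<bar>H y\<bar> * y) * \<bar>P (r y) - P (s y)\<bar>"
      using n y by (simp add: abs_mult)
    \<comment> \<open>The explicit factor y of \<open>F3\<close> is bounded by \<open>Y\<close>,
      which is what makes this Lipschitz constant small.\<close>
    also have "\<dots> \<le> ((real n - 1) * K * Y) * (L * e)"
      unfolding e_def
      by (intro mult_mono L3 K order.trans[OF small(1) \<delta>(2)] r s y)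
         (use n y Y K0 in auto)
    also have "\<dots> = (A * L * Y) * e" by (simp add: A_def)
    also have "\<dots> \<le> 1/4 * e" using Y e by (intro mult_right_mono) auto
    finally have f3: "\<bar>F3 l m n H (r y) y - F3 l m n H (s y) y\<bar> \<le> 1/4 * e" .
    have "\<bar>rhs l m n H r y - rhs l m n H s y\<bar> \<le>
        1/10 * e + (1/10 * e + (real (l + m) + 1/10) * (d * y / 2)) + 1/4 * e"
      unfolding rhs_def using f1 f2 f3 by linarith
    also have "\<dots> \<le> 9/20 * (d * y) + (real (l + m) + 1/10) * (d * y / 2)"
      using e by simp
    also have "\<dots> = real (l + m + 1) * (d / 2) * y" by (simp add: algebra_simps)
    finally show ?thesis .
  qed
  have bdd: "\<bar>rhs l m n H r y\<bar> \<le> real (l + m + 1) * M * y"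
    if r: "r \<in> X_ball Y M" and y: "y \<in> {0<..Y}" for r y
  proof -
    \<comment> \<open>The bound follows by comparison with the zero function: the Lipschitz estimate
      with \<open>d = M\<close> uses half of the allowed size, and the value at zero fits into the
      other half.\<close>
    define z :: "real \<Rightarrow> real" where "z = (\<lambda>_\<in>{0<..Y}. 0)"
    have z: "z \<in> X_ball Y M" unfolding z_def by (rule zero_in_X_ball) (use Y M in auto)
    have "\<bar>rhs l m n H r y - rhs l m n H z y\<bar> \<le> real (l + m + 1) * (M / 2) * y"
      by (rule lip[OF r z _ y]) (use bound[OF r] in \<open>simp add: z_def\<close>)
    moreover have "\<bar>rhs l m n H z y\<bar> \<le> real (l + m + 1) * (M / 2) * y"
    proof -
      \<comment> \<open>The mean of \<open>z\<close> vanishes, and with it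
        \<open>F2\<close>.\<close>
      have "\<bar>mean z y\<bar> \<le> 0 * y / 2"
        by (rule mean_bound[OF int[OF z y]]) (use y in \<open>auto simp: z_def\<close>)
      then have "rhs l m n H z y = (real n - 1) * H y * P 0 * y"
        using y unfolding rhs_def F2_mean[OF lm(2)]
        by (simp add: z_def F1_def F3_def P_def c_def)
      then have "\<bar>rhs l m n H z y\<bar> = (real n - 1) * \<bar>H y\<bar> * P 0 * y"
        using n y by (simp add: abs_mult P_def)
      also have "\<dots> \<le> (real n - 1) * K * P 0 * y"
        using n y Y K by (intro mult_right_mono mult_left_mono) (auto simp: P_def)
      also have "\<dots> \<le> M * y"
        using y by (simp add: M_def A_def)
      also have "\<dots> \<le> real (l + m + 1) / 2 * (M * y)"
        using y M lm by simp
      finally show ?thesis by (simp add: mult_ac)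
    qed
    moreover have "real (l + m + 1) * M * y =
        real (l + m + 1) * (M / 2) * y + real (l + m + 1) * (M / 2) * y" by simp
    ultimately show ?thesis by linarith
  qed
  show thesis
  proof (rule that[of M Y])
    show "F2_denom l m r y \<noteq> 0" if "r \<in> X_ball Y M" "y \<in> {0<..Y}" for r y
      using denom[OF small(2)[OF that]] lm unfolding F2_denom_mean[OF lm(2)] c_def by simp
  qed (use M Y lip bdd in auto)
qed

section \<open>The integral equation and the initial value problem\<close>

lemma integral_eq_unique_solution:
  assumes lm: "l \<ge> 1" "m \<ge> 1" and n: "n = l + m + 2" and "Y\<^sub>0 > 0"
    and H: "H \<in> borel_measurable (lebesgue_on {0..Y\<^sub>0})" "bounded (H ` {0..Y\<^sub>0})"
  shows "\<exists>M>0. \<exists>Y\<in>{0<..Y\<^sub>0}. \<exists>!r. r \<in> X_ball Y M \<and> integral_eq_solution l m n H Y r"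
proof -
  obtain K where "\<And>y. y \<in> {0..Y\<^sub>0} \<Longrightarrow> \<bar>H y\<bar> \<le> K"
    using H(2) unfolding bounded_iff by (metis image_eqI real_norm_def)
  from rhs_contraction[where H=H, OF lm n assms(4) this] obtain M Y where
    MY: "0 < M" "0 < Y" "Y \<le> Y\<^sub>0"
    and denom: "\<And>r y. r \<in> X_ball Y M \<Longrightarrow> y \<in> {0<..Y} \<Longrightarrow> F2_denom l m r y \<noteq> 0"
    and lip: "\<And>r s d y. r \<in> X_ball Y M \<Longrightarrow> s \<in> X_ball Y M \<Longrightarrow>
      (\<And>x. x \<in> {0<..Y} \<Longrightarrow> \<bar>r x - s x\<bar> \<le> d * x) \<Longrightarrow> y \<in> {0<..Y} \<Longrightarrow>
      \<bar>rhs l m n H r y - rhs l m n H s y\<bar> \<le> real (l + m + 1) * (d / 2) * y"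
    and bdd: "\<And>r y. r \<in> X_ball Y M \<Longrightarrow> y \<in> {0<..Y} \<Longrightarrow>
      \<bar>rhs l m n H r y\<bar> \<le> real (l + m + 1) * M * y"
    by blast
  \<comment> \<open>The weight exponent l + m - 1 becomes \<open>k\<close>, and l + m + 1 becomes
    \<open>k + 2\<close>, the divisor in \<open>set_LINT_Ioc_bound\<close>.\<close>
  obtain k where k: "l + m = Suc k" using lm by (cases "l + m") auto
  define g where "g r \<eta> = rhs l m n H r \<eta> * \<eta> ^ k" for r \<eta>
  \<comment> \<open>The restriction makes \<open>\<Phi> r\<close> extensional, so that a fixed point
    is an equality of functions.\<close>
  define \<Phi> where "\<Phi> r = (\<lambda>y\<in>{0<..Y}. 1 / y ^ Suc k * (LINT \<eta>:{0<..y}|lebesgue. g r \<eta>))" for r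
  have "H \<in> borel_measurable (lebesgue_on {0<..Y})"
    by (rule measurable_restrict_mono[OF H(1)]) (use MY in auto)
  then have meas: "rhs l m n H r \<in> borel_measurable (lebesgue_on {0<..Y})" if "r \<in> X_ball Y M" for r
    using borel_measurable_rhs[OF lm(2) MY(2) _ that denom[OF that]] MY by simp
  have gbound: "\<bar>g r y\<bar> \<le> (real (k + 2) * M) * y ^ Suc k" if "r \<in> X_ball Y M" "y \<in> {0<..Y}" for r y
  proof -
    have "\<bar>g r y\<bar> = \<bar>rhs l m n H r y\<bar> * y ^ k" using that by (simp add: g_def abs_mult)
    also have "\<dots> \<le> (real (l + m + 1) * M * y) * y ^ k"
      using bdd[OF that] that by (intro mult_right_mono) auto
    finally show ?thesis by (simp add: k algebra_simps)
  qed
  have int: "set_integrable lebesgue {0<..Y} (g r)" if r: "r \<in> X_ball Y M" for r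
  proof (rule set_integrable_bounded_Ioc)
    have "(\<lambda>y. y ^ k) \<in> borel_measurable (lebesgue_on {0<..Y})"
      by (intro continuous_imp_measurable_on_sets_lebesgue continuous_intros) auto
    then show "g r \<in> borel_measurable (lebesgue_on {0<..Y})"
      unfolding g_def using meas[OF r] by measurable
    fix y assume y: "y \<in> {0<..Y}"
    have "y ^ Suc k \<le> Y ^ Suc k" using y by (intro power_mono) auto
    then have "(real (k + 2) * M) * y ^ Suc k \<le> (real (k + 2) * M) * Y ^ Suc k"
      using MY by (intro mult_left_mono) auto
    then show "\<bar>g r y\<bar> \<le> (real (k + 2) * M) * Y ^ Suc k"
      using gbound[OF r y] by linarith
  qed
  have int': "set_integrable lebesgue {0<..y} (g r)" if "r \<in> X_ball Y M" "y \<in> {0<..Y}" for r y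
    using set_integrable_Ioc_subset[OF int] that by simp
  have avg: "\<bar>1 / y ^ Suc k * (LINT \<eta>:{0<..y}|lebesgue. f \<eta>)\<bar> \<le> C * y"
    if "set_integrable lebesgue {0<..y} f" "0 < y"
      "\<And>x. x \<in> {0<..y} \<Longrightarrow> \<bar>f x\<bar> \<le> (real (k + 2) * C) * x ^ Suc k" for f C y
    using set_LINT_Ioc_bound[OF that] that(2)
    by (simp add: abs_mult divide_simps del: of_nat_add)
  have "\<exists>!r. r \<in> X_ball Y M \<and> \<Phi> r = r"
  proof (rule X_ball_contraction_fixed_point)
    fix r assume r: "r \<in> X_ball Y M"
    have "continuous_on {0<..Y} (\<Phi> r)"
      by (rule continuous_on_eq[of _ "\<lambda>y. 1 / y ^ Suc k * (LINT \<eta>:{0<..y}|lebesgue. g r \<eta>)"],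
          intro continuous_intros continuous_on_set_LINT_Ioc[OF int[OF r]])
         (auto simp: \<Phi>_def)
    moreover have "\<bar>\<Phi> r y\<bar> \<le> M * y" if "y \<in> {0<..Y}" for y
      using avg[OF int'[OF r that] _ gbound[OF r]] that by (simp add: \<Phi>_def)
    ultimately show "\<Phi> r \<in> X_ball Y M"
      using MY by (auto simp: X_ball_iff \<Phi>_def)
  next
    fix r s d y
    assume r: "r \<in> X_ball Y M" and s: "s \<in> X_ball Y M"
      and d: "\<And>x. x \<in> {0<..Y} \<Longrightarrow> \<bar>r x - s x\<bar> \<le> d * x" and y: "y \<in> {0<..Y}"
    note ints = int'[OF r y] int'[OF s y]
    have "\<bar>g r x - g s x\<bar> \<le> (real (k + 2) * (d / 2)) * x ^ Suc k" if "x \<in> {0<..y}" for x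
    proof -
      have x: "x \<in> {0<..Y}" using that y by auto
      have "\<bar>g r x - g s x\<bar> = \<bar>rhs l m n H r x - rhs l m n H s x\<bar> * x ^ k"
        using that by (simp add: g_def abs_mult left_diff_distrib[symmetric])
      also have "\<dots> \<le> (real (l + m + 1) * (d / 2) * x) * x ^ k"
        using lip[OF r s d x] that by (intro mult_right_mono) auto
      finally show ?thesis by (simp add: k algebra_simps)
    qed
    from avg[OF set_integral_diff(1)[OF ints] _ this]
    have "\<bar>1 / y ^ Suc k * (LINT x:{0<..y}|lebesgue. g r x - g s x)\<bar> \<le> d / 2 * y"
      using y by simp
    then show "\<bar>\<Phi> r y - \<Phi> s y\<bar> \<le> d / 2 * y"
      using y by (simp add: \<Phi>_def set_integral_diff(2)[OF ints] right_diff_distrib diff_divide_distrib)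
  qed (use MY in auto)
  \<comment> \<open>On the ball, nonvanishing of the denominator and integrability hold
    automatically, so only the fixed point equation remains.\<close>
  moreover have "integral_eq_solution l m n H Y r \<longleftrightarrow> \<Phi> r = r" if r: "r \<in> X_ball Y M" for r
  proof -
    have "r \<in> extensional {0<..Y}" using r MY by (simp add: X_ball_iff)
    then have "\<Phi> r = r \<longleftrightarrow> (\<forall>y\<in>{0<..Y}. r y = 1 / y ^ Suc k * (LINT \<eta>:{0<..y}|lebesgue. g r \<eta>))"
      unfolding \<Phi>_def by (auto simp: fun_eq_iff extensional_def restrict_def)
    then show ?thesis
      using denom[OF r] int'[OF r]
      unfolding integral_eq_solution_def rhs_def[symmetric] k diff_Suc_1 g_def by blast
  qed
  ultimately have "\<exists>!r. r \<in> X_ball Y M \<and> integral_eq_solution l m n H Y r"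
    by (metis (mono_tags, lifting))
  with MY show ?thesis
    by (intro exI[of _ M] bexI[of _ Y] conjI) simp_all
qed

text \<open>The function y^(l+m) r(y) is the integral of \<open>g\<close>, which is continuous on
  (0,Y] when \<open>H\<close> is. As \<open>r\<close> is extensional, its value at 0 carries no
  information, and the update supplies the continuous extension.\<close>

lemma integral_eq_solution_imp_ivp_solution:
  assumes lm: "l \<ge> 1" "m \<ge> 1" and MY: "0 < M" "0 < Y"
    and H: "continuous_on {0..Y} H"
    and r: "r \<in> X_ball Y M" and sol: "integral_eq_solution l m n H Y r"
  shows "ivp_solution l m n H Y (r(0 := 0))"
proof -
  let ?u = "r(0 := 0)"
  obtain k where k: "l + m = Suc k" using lm by (cases "l + m") auto
  define g where "g \<eta> = rhs l m n H r \<eta> * \<eta> ^ k" for \<eta>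
  have denom: "F2_denom l m r y \<noteq> 0" if "y \<in> {0<..Y}" for y
    using sol that by (simp add: integral_eq_solution_def)
  have int: "set_integrable lebesgue {0<..y} g"
    and eq: "r y = 1 / y ^ Suc k * (LINT \<eta>:{0<..y}|lebesgue. g \<eta>)" if "y \<in> {0<..Y}" for y
    using sol that unfolding integral_eq_solution_def rhs_def[symmetric] k diff_Suc_1 g_def
    by blast+
  have cr: "continuous_on {0<..Y} r" and bound: "\<And>y. y \<in> {0<..Y} \<Longrightarrow> \<bar>r y\<bar> \<le> M * y"
    using r MY by (auto simp: X_ball_iff)
  \<comment> \<open>The update happens at 0, outside the domain of integration.\<close>
  have mean_u: "(LINT \<xi>:{0<..y}|lebesgue. ?u \<xi>) = (LINT \<xi>:{0<..y}|lebesgue. r \<xi>)" for y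
    unfolding set_lebesgue_integral_def
    by (rule Bochner_Integration.integral_cong) (auto simp: indicator_def)
  \<comment> \<open>Continuity of \<open>powr\<close> requires a nonzero base.\<close>
  have "1 + (\<rho> + sqrt (real l / real m))\<^sup>2 \<noteq> 0" for \<rho>
    by (metis add_nonneg_eq_0_iff zero_le_one zero_le_power2 zero_neq_one)
  moreover have "continuous_on {0<..Y} H" using H by (rule continuous_on_subset) auto
  ultimately have "continuous_on {0<..Y} (\<lambda>y. F3 l m n H (r y) y)"
    unfolding F3_def using cr by (intro continuous_intros) auto
  moreover have "continuous_on {0<..Y} (\<lambda>y. F1 l m (r y) + F2 l m r y)"
    using continuous_on_F1_F2[OF lm(2) _ _ r] MY denom by simp
  ultimately have "continuous_on {0<..Y} (\<lambda>y. F3 l m n H (r y) y + (F1 l m (r y) + F2 l m r y))"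
    by (rule continuous_on_add)
  then have "continuous_on {0<..Y} (rhs l m n H r)"
    unfolding rhs_def by (simp only: add.commute)
  then have cg: "continuous_on {0<..Y} g"
    unfolding g_def by (intro continuous_intros)
  have "\<exists>D. (?u has_real_derivative D) (at y within {0..Y}) \<and>
        y * D = - real (l + m) * ?u y + F1 l m (?u y) + F2 l m ?u y + F3 l m n H (?u y) y"
    if y: "y \<in> {0<..Y}" for y
  proof -
    have u: "integral {0..x} g / x ^ Suc k = ?u x" if "x \<in> {0<..Y}" for x
      using eq[OF that] set_LINT_Ioc(2)[OF int[OF that]] that by simp
    have at: "at y within {0<..Y} = at y within {0..Y}"
      by (rule at_within_nhd[of _ "{0<..}"]) (use y in auto)
    have "continuous (at y within {0..Y}) g"
      using cg y by (simp add: continuous_on_eq_continuous_within at[symmetric])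
    then have "((\<lambda>x. integral {0..x} g) has_real_derivative g y) (at y within {0..Y})"
      using integral_has_vector_derivative_continuous_at[OF set_LINT_Ioc(1)[OF int[of Y]], of y "{}"] y MY
      by (simp add: has_real_derivative_iff_has_vector_derivative)
    from DERIV_divide[OF this DERIV_pow[of "Suc k"]]
    have "((\<lambda>x. integral {0..x} g / x ^ Suc k) has_real_derivative
        (g y * y ^ Suc k - integral {0..y} g * (real (Suc k) * y ^ k)) / (y ^ Suc k * y ^ Suc k))
        (at y within {0..Y})" using y by simp
    moreover define D where
      "D = (g y * y ^ Suc k - integral {0..y} g * (real (Suc k) * y ^ k)) / (y ^ Suc k * y ^ Suc k)"
    ultimately have der: "((\<lambda>x. integral {0..x} g / x ^ Suc k) has_real_derivative D) (at y within {0..Y})"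
      by simp
    have "(?u has_real_derivative D) (at y within {0..Y})"
    \<comment> \<open>The radius y excludes x = 0, so the integral formula for \<open>r\<close>
      applies throughout.\<close>
    proof (rule has_field_derivative_transform_within[OF der])
      fix x assume "x \<in> {0..Y}" "dist x y < y"
      then show "integral {0..x} g / x ^ Suc k = ?u x"
        using u[of x] by (auto simp: dist_real_def)
    qed (use y in auto)
    moreover have "y * D = - real (Suc k) * r y + rhs l m n H r y"
    proof -
      have I: "integral {0..y} g = r y * (y * y ^ k)" using u[OF y] y by (simp add: field_simps)
      have "y ^ k \<noteq> 0" using y by simp
      then show ?thesis using y unfolding D_def I g_def by (simp add: field_simps)
    qed
    moreover have "F2 l m ?u y = F2 l m r y"
      using y unfolding F2_def F2_denom_def mean_u by simp
    ultimately show ?thesis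
      using y by (intro exI[of _ D]) (simp add: k rhs_def)
  qed
  note deriv = this
  moreover have "F2_denom l m ?u y \<noteq> 0" if "y \<in> {0<..Y}" for y
    using denom[OF that] unfolding F2_denom_def mean_u .
  moreover have "continuous_on {0..Y} ?u"
    unfolding continuous_on_eq_continuous_within
  proof
    fix y assume y: "y \<in> {0..Y}"
    show "continuous (at y within {0..Y}) ?u"
    proof (cases "y = 0")
      case True
      \<comment> \<open>At 0 the ball condition squeezes \<open>r\<close> between multiples of x;
        elsewhere continuity follows from differentiability.\<close>
      have "(?u \<longlongrightarrow> 0) (at 0 within {0..Y})"
      proof (rule Lim_null_comparison)
        show "\<forall>\<^sub>F x in at 0 within {0..Y}. norm (?u x) \<le> M * x"
          using bound by (auto simp: eventually_at_filter intro!: always_eventually)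
        show "((\<lambda>x. M * x) \<longlongrightarrow> 0) (at 0 within {0..Y})"
          by (auto intro!: tendsto_eq_intros)
      qed
      then show ?thesis using True by (simp add: continuous_within)
    next
      case False
      then show ?thesis using deriv[of y] y DERIV_continuous by fastforce
    qed
  qed
  ultimately show ?thesis unfolding ivp_solution_def by simp
qed

text \<open>The second conjunct quantifies over all \<open>M\<close> and \<open>Y\<close>, so it
  applies to whichever pair the first one provides.\<close>

theorem proposition4p4:
  fixes l m n :: nat and Y\<^sub>0 :: real and H :: "real \<Rightarrow> real"
  assumes "l \<ge> 1" and "m \<ge> 1" and "n = l + m + 2" and "Y\<^sub>0 > 0"
    and "H \<in> borel_measurable (lebesgue_on {0..Y\<^sub>0})"
  shows "(bounded (H ` {0..Y\<^sub>0}) \<longrightarrow>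
           (\<exists>M>0. \<exists>Y\<in>{0<..Y\<^sub>0}. \<exists>!r. r \<in> X_ball Y M \<and> integral_eq_solution l m n H Y r)) \<and>
         (bounded (H ` {0..Y\<^sub>0}) \<and> continuous_on {0..Y\<^sub>0} H \<longrightarrow>
           (\<forall>M>0. \<forall>Y\<in>{0<..Y\<^sub>0}.
             (\<exists>!r. r \<in> X_ball Y M \<and> integral_eq_solution l m n H Y r) \<longrightarrow>
             (\<forall>r. r \<in> X_ball Y M \<and> integral_eq_solution l m n H Y r \<longrightarrow>
                ivp_solution l m n H Y (r(0 := 0)))))"
proof (intro conjI impI allI ballI)
  show "\<exists>M>0. \<exists>Y\<in>{0<..Y\<^sub>0}. \<exists>!r. r \<in> X_ball Y M \<and> integral_eq_solution l m n H Y r"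
    if "bounded (H ` {0..Y\<^sub>0})"
    using integral_eq_unique_solution assms that by blast
next
  fix M Y r
  assume "bounded (H ` {0..Y\<^sub>0}) \<and> continuous_on {0..Y\<^sub>0} H" and M: "M > 0"
    and Y: "Y \<in> {0<..Y\<^sub>0}" and r: "r \<in> X_ball Y M \<and> integral_eq_solution l m n H Y r"
  then have "continuous_on {0..Y} H"
    by (auto intro: continuous_on_subset)
  with M Y r show "ivp_solution l m n H Y (r(0 := 0))"
    using integral_eq_solution_imp_ivp_solution assms(1,2) by simp
qed

end
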